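(* Let $(E,d)$ be a nonempty complete metric space, and let $T,S:E\to B(E)$ be two mappings, where $B(E)$ denotes the family of all nonempty bounded subsets of $E$. Suppose there are $\varphi\in\Phi$, $\psi\in\Psi$ and $f\in\Omega$ such that for all $x,y\in E$ $$f(\delta(Tx,Sy))\le f(M(x,y))-\varphi(f(M(x,y)))+\psi(N(x,y)).$$ Then $S$ and $T$ have a common end point, i.e. there exists $z\in E$ with $Sz=Tz=\{z\}$.
   Context: For $A,B\in B(E)$ put $D(A,B)=\inf\{d(a,b):a\in A,\ b\in B\}$ and $\delta(A,B)=\sup\{d(a,b):a\in A,\ b\in B\}$; a point $x$ appearing as an argument of $D$ or $\delta$ stands for the singleton $\{x\}$. For $T,S:E\to B(E)$ and $x,y\in E$ define $$M(x,y)=\max\left\{d(x,y),\ \delta(Tx,x),\ \delta(y,Sy),\ \frac{D(y,Tx)+D(x,Sy)}{2}\right\},\qquad N(x,y)=\min\{D(y,Tx),D(x,Sy)\}.$$ An end point of $T:E\to B(E)$ is a point $x\in E$ with $T(x)=\{x\}$. $\Phi$ is the class of all $\varphi:[0,\infty)\to[0,\infty)$ such that: (i) $\varphi(t)=0$ if and only if $t=0$; (ii) $\varphi$ is lower semicontinuous; (iii) for any sequence $\{t_n\}$ in $[0,\infty)$ with $\lim_{n\to\infty}t_n=0$ there exist $k\in(0,1)$ and $n_0\in\mathbb{N}$ such that $\varphi(t_n)\ge k t_n$ for each $n\ge n_0$. $\Omega$ is the class of all $f:[0,\infty)\to[0,\infty)$ such that: (i) $f(t)=0$ if and only if $t=0$;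 (ii) $f$ is non-decreasing; (iii) $f$ is continuous; (iv) $f(x+y)\le f(x)+f(y)$ for all $x,y\in[0,\infty)$. $\Psi$ is the class of all $\psi:[0,\infty)\to[0,\infty)$ that are continuous and non-decreasing with $\psi(t)=0$ if and only if $t=0$. *)

theory Defs
  imports "HOL-Analysis.Analysis"
begin

text \<open>The family \<open>B(E)\<close>, with \<open>E\<close> the whole type.\<close>

definition nonempty_bounded_sets :: "'a::metric_space set set" where
  "nonempty_bounded_sets = {A. A \<noteq> {} \<and> bounded A}"

text \<open>
  The infimum distance \<open>D(A,B)\<close> is the library's \<^const>\<open>setdist\<close>. Its counterpart \<open>\<delta>(A,B)\<close>
  is a real supremum, so it is meaningful only for nonempty bounded arguments.
\<close>

definition sup_setdist :: "'a::metric_space set \<Rightarrow> 'a set \<Rightarrow> real" where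
  "sup_setdist A B = Sup {dist a b | a b. a \<in> A \<and> b \<in> B}"

definition M_term :: "('a::metric_space \<Rightarrow> 'a set) \<Rightarrow> ('a \<Rightarrow> 'a set) \<Rightarrow> 'a \<Rightarrow> 'a \<Rightarrow> real" where
  "M_term T S x y =
     Max {dist x y, sup_setdist (T x) {x}, sup_setdist {y} (S y),
          (setdist {y} (T x) + setdist {x} (S y)) / 2}"

definition N_term :: "('a::metric_space \<Rightarrow> 'a set) \<Rightarrow> ('a \<Rightarrow> 'a set) \<Rightarrow> 'a \<Rightarrow> 'a \<Rightarrow> real" where
  "N_term T S x y = min (setdist {y} (T x)) (setdist {x} (S y))"

definition end_point :: "('a \<Rightarrow> 'a set) \<Rightarrow> 'a \<Rightarrow> bool" where
  "end_point T x \<longleftrightarrow> T x = {x}"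

definition lower_semicontinuous_on :: "'a::topological_space set \<Rightarrow> ('a \<Rightarrow> real) \<Rightarrow> bool" where
  "lower_semicontinuous_on A g \<longleftrightarrow>
     (\<forall>t\<in>A. \<forall>c < g t. eventually (\<lambda>s. c < g s) (at t within A))"

text \<open>
  Functions \<open>[0,\<infinity>) \<rightarrow> [0,\<infinity>)\<close> are represented by total functions on the reals
  mapping \<open>{0..}\<close> into itself; their values at negative arguments are unconstrained.
\<close>

definition Phi_class :: "(real \<Rightarrow> real) set" where
  "Phi_class = {\<phi>. \<phi> \<in> {0..} \<rightarrow> {0..} \<and>
     (\<forall>t\<ge>0. \<phi> t = 0 \<longleftrightarrow> t = 0) \<and>
     lower_semicontinuous_on {0..} \<phi> \<and>
     (\<forall>t :: nat \<Rightarrow> real. (\<forall>n. t n \<ge> 0) \<and> t \<longlonglongrightarrow> 0 \<longrightarrow>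
        (\<exists>k n0. 0 < k \<and> k < 1 \<and> (\<forall>n\<ge>n0. \<phi> (t n) \<ge> k * t n)))}"

definition Omega_class :: "(real \<Rightarrow> real) set" where
  "Omega_class = {f. f \<in> {0..} \<rightarrow> {0..} \<and>
     (\<forall>t\<ge>0. f t = 0 \<longleftrightarrow> t = 0) \<and>
     mono_on {0..} f \<and>
     continuous_on {0..} f \<and>
     (\<forall>x\<ge>0. \<forall>y\<ge>0. f (x + y) \<le> f x + f y)}"

definition Psi_class :: "(real \<Rightarrow> real) set" where
  "Psi_class = {\<psi>. \<psi> \<in> {0..} \<rightarrow> {0..} \<and>
     continuous_on {0..} \<psi> \<and>
     mono_on {0..} \<psi> \<and>
     (\<forall>t\<ge>0. \<psi> t = 0 \<longleftrightarrow> t = 0)}"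

end

theory Submission
  imports Defs
begin

text \<open>
  Iterating \<open>T\<close> and \<open>S\<close> alternately from any point, the term \<open>N\<close> vanishes along the orbit
  \<open>x\<^sub>n\<close>, so the numbers \<open>u\<^sub>n = f (\<delta>(x\<^sub>n, F\<^sub>n x\<^sub>n))\<close>, with \<open>F\<^sub>n\<close> alternately \<open>T\<close> and \<open>S\<close>, satisfy
  \<open>u\<^sub>n\<^sub>+\<^sub>1 \<le> u\<^sub>n - \<phi>(u\<^sub>n)\<close>. Lower semicontinuity forces \<open>u\<^sub>n \<longlonglongrightarrow> 0\<close>, and the linear lower bound on
  \<open>\<phi>\<close> near \<open>0\<close> then makes the decay geometric. Hence \<open>\<Sum>u\<^sub>n\<close> converges, and subadditivity of \<open>f\<close>
  makes the orbit Cauchy. Passing to the limit in the contractive condition at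
  \<open>(z, x\<^sub>2\<^sub>n\<^sub>+\<^sub>1)\<close> yields \<open>\<phi>(f(\<delta>(Tz,z))) = 0\<close>, and the condition at \<open>(z,z)\<close> does the same for \<open>S\<close>.
\<close>

section \<open>The distances between sets\<close>

lemma nonempty_bounded_singleton [simp]: "{x} \<in> nonempty_bounded_sets"
  by (simp add: nonempty_bounded_sets_def)

lemma sup_setdist_commute: "sup_setdist A B = sup_setdist B A"
proof -
  have "{dist a b |a b. a \<in> A \<and> b \<in> B} = {dist a b |a b. a \<in> B \<and> b \<in> A}"
    by (auto, (metis dist_commute)+)
  then show ?thesis by (simp add: sup_setdist_def)
qed

text \<open>A real \<open>Sup\<close> dominates its set only when that set is bounded above;
  boundedness of \<open>A \<union> B\<close> supplies the common bound.\<close>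

lemma dist_le_sup_setdist:
  assumes "A \<in> nonempty_bounded_sets" "B \<in> nonempty_bounded_sets" "a \<in> A" "b \<in> B"
  shows "dist a b \<le> sup_setdist A B"
proof -
  from assms have "bounded (A \<union> B)" by (auto simp: nonempty_bounded_sets_def)
  then obtain e where "\<And>a b. a \<in> A \<Longrightarrow> b \<in> B \<Longrightarrow> dist a b \<le> e"
    by (meson UnCI bounded_two_points)
  then have "bdd_above {dist a b |a b. a \<in> A \<and> b \<in> B}"
    by (auto simp: bdd_above_def)
  then show ?thesis
    unfolding sup_setdist_def using assms by (intro cSup_upper) auto
qed

lemma sup_setdist_least:
  assumes "A \<in> nonempty_bounded_sets" "B \<in> nonempty_bounded_sets"
    and "\<And>a b. a \<in> A \<Longrightarrow> b \<in> B \<Longrightarrow> dist a b \<le> c"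
  shows "sup_setdist A B \<le> c"
  unfolding sup_setdist_def using assms
  by (intro cSup_least) (auto simp: nonempty_bounded_sets_def)

lemma sup_setdist_nonneg:
  assumes "A \<in> nonempty_bounded_sets" "B \<in> nonempty_bounded_sets"
  shows "0 \<le> sup_setdist A B"
proof -
  obtain a b where "a \<in> A" "b \<in> B" using assms by (auto simp: nonempty_bounded_sets_def)
  then show ?thesis using dist_le_sup_setdist[OF assms] by (meson order_trans zero_le_dist)
qed

lemma setdist_le_sup_setdist:
  assumes "A \<in> nonempty_bounded_sets" "B \<in> nonempty_bounded_sets"
  shows "setdist A B \<le> sup_setdist A B"
proof -
  obtain a b where "a \<in> A" "b \<in> B" using assms by (auto simp: nonempty_bounded_sets_def)
  then show ?thesis
    using dist_le_sup_setdist[OF assms] setdist_le_dist by (meson order_trans)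
qed

lemma sup_setdist_mono_left:
  assumes "A \<in> nonempty_bounded_sets" "B \<in> nonempty_bounded_sets" "a \<in> A"
  shows "sup_setdist {a} B \<le> sup_setdist A B"
  using assms by (intro sup_setdist_least) (auto intro: dist_le_sup_setdist)

text \<open>Used with \<open>x\<close> and \<open>y\<close> in both roles, this makes \<delta> to a
  fixed set 1-Lipschitz in the point, so it passes to limits.\<close>

lemma sup_setdist_triangle_point:
  assumes "A \<in> nonempty_bounded_sets"
  shows "sup_setdist A {x} \<le> sup_setdist A {y} + dist x y"
proof (rule sup_setdist_least)
  fix a b assume "a \<in> A" "b \<in> {x}"
  then show "dist a b \<le> sup_setdist A {y} + dist x y"
    using dist_le_sup_setdist[OF assms, of "{y}" a y] dist_triangle[of a x y]
    by (auto simp: dist_commute)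
qed (use assms in auto)

lemma eq_singleton_if_sup_setdist_0:
  assumes "A \<in> nonempty_bounded_sets" "sup_setdist A {x} = 0"
  shows "A = {x}"
proof -
  have "a = x" if "a \<in> A" for a
    using dist_le_sup_setdist[OF assms(1), of "{x}" a x] that assms(2) by simp
  then show ?thesis using assms(1) by (auto simp: nonempty_bounded_sets_def)
qed

lemma M_term_swap: "M_term S T y x = M_term T S x y"
  unfolding M_term_def sup_setdist_commute[of "S y" "{y}"] sup_setdist_commute[of "{x}" "T x"]
    dist_commute[of y x] add.commute[of "setdist {x} (S y)"]
  by (simp add: insert_commute)

lemma N_term_swap: "N_term S T y x = N_term T S x y"
  by (simp add: N_term_def min.commute)

section \<open>The classes of control functions\<close>

text \<open>The majorant \<open>v\<close> need not be \<open>g\<close> along \<open>u\<close>: a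
  level \<open>c\<close> strictly between \<open>b\<close> and \<open>g l\<close> would eventually
  lie below \<open>v\<close>, hence below its limit.\<close>

lemma lower_semicontinuous_on_lim_le:
  assumes lsc: "lower_semicontinuous_on A g"
    and u: "u \<longlonglongrightarrow> l" "\<And>n. u n \<in> A" "l \<in> A"
    and v: "v \<longlonglongrightarrow> b" "\<And>n. g (u n) \<le> v n"
  shows "g l \<le> b"
proof (rule ccontr)
  assume "\<not> g l \<le> b"
  then obtain c where c: "b < c" "c < g l" by (meson dense not_le)
  then have "eventually (\<lambda>s. c < g s) (at l within A)"
    using lsc u(3) by (auto simp: lower_semicontinuous_on_def)
  \<comment> \<open>The filter \<open>at l within A\<close> omits \<open>l\<close> itself; there the
    bound is the choice of \<open>c\<close>.\<close>
  then obtain U where U: "open U" "l \<in> U" "\<And>s. s \<in> U \<Longrightarrow> s \<in> A \<Longrightarrow> c < g s"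
    using c by (metis eventually_at_topological)
  from topological_tendstoD[OF u(1) U(1,2)] have "eventually (\<lambda>n. c \<le> v n) sequentially"
    by eventually_elim (use U(3) u(2) v(2) in \<open>meson less_le_trans less_imp_le\<close>)
  then have "c \<le> b" using tendsto_lowerbound[OF v(1)] by simp
  with c show False by simp
qed

lemma Omega_class_less_cancel:
  assumes "f \<in> Omega_class" "f s < f t" "0 \<le> s" "0 \<le> t"
  shows "s < t"
proof (rule ccontr)
  assume "\<not> s < t"
  then have "f t \<le> f s"
    using assms by (intro mono_onD[of "{0..}" f]) (auto simp: Omega_class_def)
  with assms(2) show False by simp
qed

text \<open>Monotonicity and subadditivity let \<open>f\<close> inherit the triangle inequality from
  \<open>dist\<close>.\<close>

lemma Omega_class_dist_le_sum:
  assumes f: "f \<in> Omega_class" and "m \<le> n"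
  shows "f (dist (x m) (x n)) \<le> (\<Sum>i = m..<n. f (dist (x i) (x (Suc i))))"
  using \<open>m \<le> n\<close>
proof (induction n rule: dec_induct)
  case base
  then show ?case using f by (auto simp: Omega_class_def)
next
  case (step n)
  have "f (dist (x m) (x (Suc n))) \<le> f (dist (x m) (x n) + dist (x n) (x (Suc n)))"
    using f by (auto simp: Omega_class_def intro!: mono_onD[of "{0..}" f] dist_triangle)
  also have "\<dots> \<le> f (dist (x m) (x n)) + f (dist (x n) (x (Suc n)))"
    using f by (auto simp: Omega_class_def)
  finally show ?case using step by simp
qed

text \<open>The tails of the series are compared with \<open>f e\<close> instead of
  \<open>e\<close>, and monotonicity of \<open>f\<close> turns this back into a bound on
  distances.\<close>

lemma Omega_class_Cauchy:
  fixes x :: "nat \<Rightarrow> 'a::metric_space"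
  assumes f: "f \<in> Omega_class" and sm: "summable (\<lambda>i. f (dist (x i) (x (Suc i))))"
  shows "Cauchy x"
proof (rule metric_CauchyI)
  fix e :: real assume e: "0 < e"
  then have "0 < f e"
    using f by (auto simp: Omega_class_def less_le Pi_def)
  then obtain M where M: "\<And>m n. m \<ge> M \<Longrightarrow> \<bar>\<Sum>i = m..<n. f (dist (x i) (x (Suc i)))\<bar> < f e"
    using sm unfolding summable_Cauchy by (metis real_norm_def)
  have *: "dist (x m) (x n) < e" if "M \<le> m" "m \<le> n" for m n
    using Omega_class_dist_le_sum[OF f \<open>m \<le> n\<close>, of x] M[OF \<open>M \<le> m\<close>, of n] e
    by (auto intro: Omega_class_less_cancel[OF f])
  show "\<exists>M. \<forall>m\<ge>M. \<forall>n\<ge>M. dist (x m) (x n) < e"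
    by (metis * dist_commute nle_le)
qed

lemma Phi_class_summable:
  assumes phi: "\<phi> \<in> Phi_class" and u: "\<And>n. 0 \<le> u n" "\<And>n. u (Suc n) \<le> u n - \<phi> (u n)"
  shows "summable u"
proof -
  have phi_nonneg: "0 \<le> \<phi> (u n)" for n
    using phi u(1)[of n] by (auto simp: Phi_class_def)
  have "u (Suc n) \<le> u n" for n using u(2)[of n] phi_nonneg[of n] by simp
  then have "decseq u" by (rule decseq_SucI)
  then obtain l where l: "u \<longlonglongrightarrow> l"
    using u(1) decseq_convergent[of u 0] by blast
  have l0: "0 \<le> l" using l u(1) by (meson LIMSEQ_le_const)
  have "\<phi> l \<le> l - l"
  proof (rule lower_semicontinuous_on_lim_le[OF _ l])
    show "lower_semicontinuous_on {0..} \<phi>" using phi by (simp add: Phi_class_def)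
    \<comment> \<open>The decrements majorize \<open>\<phi> (u n)\<close> and tend to 0.\<close>
    show "(\<lambda>n. u n - u (Suc n)) \<longlonglongrightarrow> l - l"
      by (intro tendsto_diff l LIMSEQ_Suc)
    show "\<phi> (u n) \<le> u n - u (Suc n)" for n using u(2)[of n] by simp
  qed (use u(1) l0 in auto)
  then have "l = 0" using phi l0 by (force simp: Phi_class_def Pi_def)
  \<comment> \<open>The constant \<open>k\<close> may depend on the null sequence, so the condition
    is applied to \<open>u\<close> itself; the ratio is then \<open>1 - k\<close>.\<close>
  with l phi u(1) obtain k n0 where k: "0 < k" "k < 1" "\<And>n. n \<ge> n0 \<Longrightarrow> k * u n \<le> \<phi> (u n)"
    unfolding Phi_class_def by blast
  show ?thesis
  proof (rule summable_ratio_test[of "1 - k" n0])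
    fix n assume "n0 \<le> n"
    then show "norm (u (Suc n)) \<le> (1 - k) * norm (u n)"
      using k(3)[of n] u(1)[of n] u(1)[of "Suc n"] u(2)[of n] by (simp add: algebra_simps)
  qed (use k in auto)
qed

section \<open>Weakly contractive pairs\<close>

locale weakly_contractive_pair =
  fixes T S :: "'a::complete_space \<Rightarrow> 'a set"
    and \<phi> \<psi> f :: "real \<Rightarrow> real"
  assumes T_bounded: "T x \<in> nonempty_bounded_sets"
    and S_bounded: "S x \<in> nonempty_bounded_sets"
    and phi: "\<phi> \<in> Phi_class" and psi: "\<psi> \<in> Psi_class" and f: "f \<in> Omega_class"
    and contractive: "f (sup_setdist (T x) (S y))
           \<le> f (M_term T S x y) - \<phi> (f (M_term T S x y)) + \<psi> (N_term T S x y)"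
begin

text \<open>Exchanging the maps together with the points preserves \<open>M_term\<close> and
  \<open>N_term\<close>; this makes results about a \<open>T\<close>-step available for an
  \<open>S\<close>-step.\<close>

lemma swap: "weakly_contractive_pair S T \<phi> \<psi> f"
  using T_bounded S_bounded phi psi f contractive
  by unfold_locales (simp_all add: M_term_swap N_term_swap sup_setdist_commute[of "S _" "T _"])

lemma f_nonneg: "0 \<le> t \<Longrightarrow> 0 \<le> f t"
  and f_eq_0: "0 \<le> t \<Longrightarrow> f t = 0 \<longleftrightarrow> t = 0"
  and f_mono: "0 \<le> s \<Longrightarrow> s \<le> t \<Longrightarrow> f s \<le> f t"
  using f by (auto simp: Omega_class_def mono_on_def Pi_def)

lemma phi_le_0: "0 \<le> t \<Longrightarrow> \<phi> t \<le> 0 \<Longrightarrow> t = 0"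
  using phi by (force simp: Phi_class_def Pi_def)

lemma phi_f_le_0: "0 \<le> t \<Longrightarrow> \<phi> (f t) \<le> 0 \<Longrightarrow> t = 0"
  using phi_le_0[of "f t"] f_nonneg f_eq_0 by blast

lemma psi_0: "\<psi> 0 = 0"
  using psi by (auto simp: Psi_class_def)

lemma f_tendsto:
  assumes "u \<longlonglongrightarrow> l" "\<And>n. 0 \<le> u n" "0 \<le> l"
  shows "(\<lambda>n. f (u n)) \<longlonglongrightarrow> f l"
  using f assms by (intro continuous_on_tendsto_compose[of "{0..}" f]) (auto simp: Omega_class_def)

lemma psi_tendsto_0:
  assumes "u \<longlonglongrightarrow> 0" "\<And>n. 0 \<le> u n"
  shows "(\<lambda>n. \<psi> (u n)) \<longlonglongrightarrow> 0"
  using continuous_on_tendsto_compose[of "{0..}" \<psi> u 0 sequentially] psi assms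
  by (auto simp: Psi_class_def)

text \<open>Choosing \<open>y\<close> in \<open>T x\<close> kills \<open>N_term\<close>, hence the
  \<psi> term, and reduces \<open>M_term\<close> to \<open>max a b\<close>.\<close>

lemma contractive_step:
  assumes y: "y \<in> T x"
  defines "a \<equiv> sup_setdist (T x) {x}" and "b \<equiv> sup_setdist (S y) {y}"
  shows "f b \<le> f a - \<phi> (f a)"
proof -
  have a0: "0 \<le> a" and b0: "0 \<le> b"
    unfolding a_def b_def using T_bounded S_bounded by (auto intro: sup_setdist_nonneg)
  have D0: "setdist {y} (T x) = 0"
    using y setdist_eq_0_sing_1 closure_subset by blast
  then have N: "N_term T S x y = 0" by (simp add: N_term_def)
  have d: "dist x y \<le> a"
    unfolding a_def using dist_le_sup_setdist[OF T_bounded, of "{x}" y x x] y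
    by (simp add: dist_commute)
  have "setdist {x} (S y) \<le> dist x y + setdist {y} (S y)"
    using setdist_triangle[of "{x}" "S y" y] by simp
  also have "setdist {y} (S y) \<le> b"
    unfolding b_def using setdist_le_sup_setdist[OF _ S_bounded, of "{y}" y]
    by (simp add: sup_setdist_commute)
  \<comment> \<open>The averaged entry is at most \<open>(a + b) / 2\<close>, so it never exceeds
    \<open>max a b\<close>.\<close>
  finally have "M_term T S x y = max a b"
    unfolding M_term_def D0 a_def[symmetric]
    using d by (auto simp: b_def sup_setdist_commute[of "{y}"] max_def)
  then have ineq: "f (sup_setdist (T x) (S y)) \<le> f (max a b) - \<phi> (f (max a b))"
    using contractive[of x y] N psi_0 by simp
  have "b \<le> sup_setdist (T x) (S y)"
    using sup_setdist_mono_left[OF T_bounded S_bounded y] by (simp add: b_def sup_setdist_commute)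
  then have le: "f b \<le> f (max a b) - \<phi> (f (max a b))"
    using ineq f_mono[OF b0] by force
  have "max a b = a"
  proof (cases "b \<le> a")
    \<comment> \<open>If \<open>a < b\<close>, the inequality reads
      \<open>f b \<le> f b - \<phi> (f b)\<close>, forcing \<open>b = 0\<close> against
      \<open>0 \<le> a\<close>.\<close>
    case False
    then have "max a b = b" by simp
    then show ?thesis using le phi_f_le_0[OF b0] False a0 by simp
  qed simp
  with le show ?thesis by simp
qed

lemma alternating_orbit_limit:
  obtains x z where "x \<longlonglongrightarrow> z"
    and "\<And>n. x (Suc n) \<in> (if even n then T else S) (x n)"
    and "(\<lambda>n. sup_setdist ((if even n then T else S) (x n)) {x n}) \<longlonglongrightarrow> 0"
proof -
  define F where "F = (\<lambda>n::nat. if even n then T else S)"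
  have F_bounded: "F n w \<in> nonempty_bounded_sets" for n w
    using T_bounded S_bounded by (simp add: F_def)
  then have "\<exists>v. v \<in> F n w" for n w
    unfolding nonempty_bounded_sets_def by blast
  then obtain x where x: "\<And>n. x (Suc n) \<in> F n (x n)"
    using dependent_nat_choice[of "\<lambda>_ _. True" "\<lambda>n w v. v \<in> F n w"] by blast
  define r where "r n = sup_setdist (F n (x n)) {x n}" for n
  have r0: "0 \<le> r n" for n
    unfolding r_def using F_bounded by (auto intro: sup_setdist_nonneg)
  \<comment> \<open>Even \<open>n\<close> is a step from \<open>T\<close> to \<open>S\<close>; odd
    \<open>n\<close> uses the exchanged pair.\<close>
  have step: "f (r (Suc n)) \<le> f (r n) - \<phi> (f (r n))" for n
    using x[of n] contractive_step[of "x (Suc n)" "x n"]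
      weakly_contractive_pair.contractive_step[OF swap, of "x (Suc n)" "x n"]
    by (auto simp: r_def F_def split: if_splits)
  then have sm: "summable (\<lambda>n. f (r n))"
    by (intro Phi_class_summable[OF phi] f_nonneg r0)
  have "dist (x n) (x (Suc n)) \<le> r n" for n
    unfolding r_def using dist_le_sup_setdist[OF F_bounded _ x, of "{x n}" "x n"]
    by (simp add: dist_commute)
  then have "summable (\<lambda>n. f (dist (x n) (x (Suc n))))"
    by (intro summable_comparison_test'[OF sm]) (auto simp: f_nonneg f_mono)
  then have "Cauchy x" by (rule Omega_class_Cauchy[OF f])
  then obtain z where z: "x \<longlonglongrightarrow> z" using Cauchy_convergent convergent_def by blast
  have fr: "(\<lambda>n. f (r n)) \<longlonglongrightarrow> 0" using sm by (rule summable_LIMSEQ_zero)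
  have "r \<longlonglongrightarrow> 0"
  proof (rule order_tendstoI)
    fix e :: real assume e: "0 < e"
    then have "0 < f e" using f_nonneg[of e] f_eq_0[of e] by simp
    from order_tendstoD(2)[OF fr this] show "eventually (\<lambda>n. r n < e) sequentially"
      by eventually_elim (use Omega_class_less_cancel[OF f] r0 e in auto)
  qed (auto intro!: always_eventually less_le_trans[OF _ r0])
  with z x show thesis by (intro that[of x z]) (auto simp: r_def[abs_def] F_def)
qed

lemma common_end_point: "\<exists>z. end_point S z \<and> end_point T z"
proof -
  obtain x z where z: "x \<longlonglongrightarrow> z"
    and x: "\<And>n. x (Suc n) \<in> (if even n then T else S) (x n)"
    and r: "(\<lambda>n. sup_setdist ((if even n then T else S) (x n)) {x n}) \<longlonglongrightarrow> 0"
    by (rule alternating_orbit_limit) (rule that)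
  \<comment> \<open>At odd indices the orbit moves by \<open>S\<close>, so \<open>w n\<close> is a
    point of \<open>S (y n)\<close> and \<delta> from \<open>y n\<close> to that set tends to
    0.\<close>
  define y where "y n = x (2 * n + 1)" for n
  define w where "w n = x (2 * n + 2)" for n
  define c where "c = sup_setdist (T z) {z}"
  define m where "m n = M_term T S z (y n)" for n
  have y: "y \<longlonglongrightarrow> z" and w: "w \<longlonglongrightarrow> z"
    unfolding y_def w_def
    by (rule LIMSEQ_subseq_LIMSEQ[OF z, unfolded o_def]; simp add: strict_mono_def)+
  have wS: "w n \<in> S (y n)" for n using x[of "2 * n + 1"] by (simp add: y_def w_def)
  have ry: "(\<lambda>n. sup_setdist {y n} (S (y n))) \<longlonglongrightarrow> 0"
    using LIMSEQ_subseq_LIMSEQ[OF r, of "\<lambda>n. 2 * n + 1"]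
    by (simp add: strict_mono_def o_def y_def sup_setdist_commute)
  have c0: "0 \<le> c" unfolding c_def using T_bounded by (auto intro: sup_setdist_nonneg)
  have dzy: "(\<lambda>n. dist z (y n)) \<longlonglongrightarrow> 0" using tendsto_dist[OF tendsto_const y, of z] by simp
  have dzw: "(\<lambda>n. dist z (w n)) \<longlonglongrightarrow> 0" using tendsto_dist[OF tendsto_const w, of z] by simp
  have DS: "setdist {z} (S (y n)) \<le> dist z (w n)" for n
    using wS by (intro setdist_le_dist) auto
  have DT: "setdist {y n} (T z) \<le> dist z (y n) + c" for n
    using setdist_triangle[of "{y n}" "T z" z] setdist_le_sup_setdist[OF _ T_bounded, of "{z}" z]
    by (simp add: c_def sup_setdist_commute dist_commute)
  have mc: "c \<le> m n" for n by (simp add: m_def M_term_def c_def)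
  \<comment> \<open>Each of the four entries is below \<open>c\<close> plus three null sequences,
    while \<open>c\<close> is itself an entry; this squeezes \<open>m\<close>.\<close>
  have m_le: "m n \<le> c + (dist z (y n) + sup_setdist {y n} (S (y n)) + dist z (w n))" for n
    using DS[of n] DT[of n] c0 sup_setdist_nonneg[OF _ S_bounded, of "{y n}" "y n"]
    unfolding m_def M_term_def c_def[symmetric]
    by (simp, insert zero_le_dist[of z "y n"] zero_le_dist[of z "w n"], linarith)
  have m: "m \<longlonglongrightarrow> c"
  proof (rule tendsto_sandwich[OF _ _ tendsto_const])
    show "(\<lambda>n. c + (dist z (y n) + sup_setdist {y n} (S (y n)) + dist z (w n))) \<longlonglongrightarrow> c"
      using tendsto_add[OF tendsto_const tendsto_add[OF tendsto_add[OF dzy ry] dzw], of c] by simp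
  qed (use mc m_le in auto)
  have m0: "0 \<le> m n" for n using c0 mc[of n] by simp
  have fm: "(\<lambda>n. f (m n)) \<longlonglongrightarrow> f c" using m m0 c0 by (rule f_tendsto)
  \<comment> \<open>The minimum is controlled by its second entry alone; the first is only known to
    be at most \<open>dist z (y n) + c\<close>.\<close>
  have N: "(\<lambda>n. N_term T S z (y n)) \<longlonglongrightarrow> 0"
    by (rule tendsto_sandwich[OF _ _ tendsto_const dzw])
       (use DS in \<open>auto simp: N_term_def setdist_pos_le min_le_iff_disj\<close>)
  have psiN: "(\<lambda>n. \<psi> (N_term T S z (y n))) \<longlonglongrightarrow> 0"
    using N by (rule psi_tendsto_0) (simp add: N_term_def setdist_pos_le)
  \<comment> \<open>Testing \<open>S (y n)\<close> at the single point \<open>w n\<close> bounds the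
    left side of the contractive condition from below by a quantity with limit
    \<open>f c\<close>.\<close>
  define s where "s n = sup_setdist (T z) {w n}" for n
  have s0: "0 \<le> s n" for n
    unfolding s_def using T_bounded by (auto intro: sup_setdist_nonneg)
  have s: "s \<longlonglongrightarrow> c"
  proof (rule tendsto_sandwich)
    show "(\<lambda>n. c - dist z (w n)) \<longlonglongrightarrow> c" "(\<lambda>n. c + dist z (w n)) \<longlonglongrightarrow> c"
      using tendsto_diff[OF tendsto_const dzw, of c] tendsto_add[OF tendsto_const dzw, of c]
      by simp_all
    show "eventually (\<lambda>n. c - dist z (w n) \<le> s n) sequentially"
      using sup_setdist_triangle_point[OF T_bounded, of z z]
      by (simp add: s_def c_def algebra_simps)
    show "eventually (\<lambda>n. s n \<le> c + dist z (w n)) sequentially"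
      using sup_setdist_triangle_point[OF T_bounded, of z _ z]
      by (simp add: s_def c_def dist_commute[of z])
  qed
  have fs: "(\<lambda>n. f (s n)) \<longlonglongrightarrow> f c" using s s0 c0 by (rule f_tendsto)
  have "\<phi> (f c) \<le> f c - f c + 0"
  proof (rule lower_semicontinuous_on_lim_le[OF _ fm])
    show "lower_semicontinuous_on {0..} \<phi>" using phi by (simp add: Phi_class_def)
    show "(\<lambda>n. f (m n) - f (s n) + \<psi> (N_term T S z (y n))) \<longlonglongrightarrow> f c - f c + 0"
      by (intro tendsto_add tendsto_diff fm fs psiN)
    show "\<phi> (f (m n)) \<le> f (m n) - f (s n) + \<psi> (N_term T S z (y n))" for n
    proof -
      have "s n \<le> sup_setdist (T z) (S (y n))"
        using sup_setdist_mono_left[OF S_bounded T_bounded wS]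
        by (simp add: s_def sup_setdist_commute)
      from f_mono[OF s0 this] show ?thesis using contractive[of z "y n"] by (simp add: m_def)
    qed
  qed (use m0 c0 f_nonneg in auto)
  then have "c = 0" using phi_f_le_0[OF c0] by simp
  then have Tz: "T z = {z}"
    using eq_singleton_if_sup_setdist_0[OF T_bounded] by (simp add: c_def)
  define b where "b = sup_setdist (S z) {z}"
  have b0: "0 \<le> b" unfolding b_def using S_bounded by (auto intro: sup_setdist_nonneg)
  \<comment> \<open>Now \<open>z\<close> lies in \<open>T z\<close>, so the step estimate applies
    with both points equal to \<open>z\<close>.\<close>
  have "f b \<le> f 0 - \<phi> (f 0)"
    using contractive_step[of z z] \<open>c = 0\<close> by (simp add: b_def c_def Tz)
  moreover have "f 0 = 0" "\<phi> 0 = 0" using f_eq_0[of 0] phi by (auto simp: Phi_class_def)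
  ultimately have "b = 0" using f_nonneg[OF b0] f_eq_0[OF b0] by simp
  then have "S z = {z}"
    using eq_singleton_if_sup_setdist_0[OF S_bounded] by (simp add: b_def)
  with Tz show ?thesis by (auto simp: end_point_def)
qed

end

theorem theorem2p1:
  fixes T S :: "'a::complete_space \<Rightarrow> 'a set"
    and \<phi> \<psi> f :: "real \<Rightarrow> real"
  assumes "\<And>x. T x \<in> nonempty_bounded_sets"
    and "\<And>x. S x \<in> nonempty_bounded_sets"
    and "\<phi> \<in> Phi_class" and "\<psi> \<in> Psi_class" and "f \<in> Omega_class"
    and "\<And>x y. f (sup_setdist (T x) (S y))
           \<le> f (M_term T S x y) - \<phi> (f (M_term T S x y)) + \<psi> (N_term T S x y)"
  shows "\<exists>z. end_point S z \<and> end_point T z"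
proof -
  interpret weakly_contractive_pair T S \<phi> \<psi> f
    by unfold_locales (fact assms)+
  show ?thesis by (rule common_end_point)
qed

end
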